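(* There is a polynomial-time algorithm that, given a Maker-Breaker poset positional game $(X,\mathcal{F},P)$ in which $P$ has height $2$, every winning set has size $1$, and $\{y\}\in\mathcal{F}$ for every non-minimal element $y$ of $P$, decides which player has a winning strategy when Maker starts.
   Context: A poset positional game is a triple $(X,\mathcal{F},P)$ with $X$ a finite board of vertices, $\mathcal{F}\subseteq 2^X$ the winning sets, and $P$ a partial order on $X$. Two players alternately claim an unclaimed vertex $v$ such that all vertices smaller than $v$ in $P$ are already claimed, until all vertices are claimed. In the Maker-Breaker convention, Maker wins if at some point she has claimed all vertices of some winning set; otherwise Breaker wins. The height of a poset is the cardinality of its longest chain. An element is minimal if no element is smaller than it. *)

theory Defs
  imports Main
begin

section \<open>Maker-Breaker poset positional games\<close>

definition poset_game :: "'a set \<Rightarrow> 'a set set \<Rightarrow> 'a rel \<Rightarrow> bool" where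
  "poset_game X F P \<longleftrightarrow> finite X \<and> F \<subseteq> Pow X \<and> partial_order_on X P"

text \<open>The order is reflexive: \<open>(x, y) \<in> P\<close> stands for \<open>x \<le> y\<close>. In particular every chain of
  \<open>P\<close> is a subset of \<open>X\<close>, since \<open>P \<subseteq> X \<times> X\<close>.\<close>

definition poset_height :: "'a rel \<Rightarrow> nat" where
  "poset_height P = Max (card ` Chains P)"

definition minimal_element :: "'a set \<Rightarrow> 'a rel \<Rightarrow> 'a \<Rightarrow> bool" where
  "minimal_element X P y \<longleftrightarrow> y \<in> X \<and> \<not> (\<exists>x\<in>X. (x, y) \<in> P \<and> x \<noteq> y)"

datatype player = Maker | Breaker

fun opponent :: "player \<Rightarrow> player" where
  "opponent Maker = Breaker"
| "opponent Breaker = Maker"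

text \<open>A position is the list \<open>h\<close> of the vertices claimed so far, in the order in which they were
  claimed. The moves are numbered from \<open>0\<close>; \<open>mover s i\<close> makes move \<open>i\<close> when \<open>s\<close> starts.\<close>

definition mover :: "player \<Rightarrow> nat \<Rightarrow> player" where
  "mover s i = (if even i then s else opponent s)"

definition legal_move :: "'a set \<Rightarrow> 'a rel \<Rightarrow> 'a list \<Rightarrow> 'a \<Rightarrow> bool" where
  "legal_move X P h v \<longleftrightarrow>
     v \<in> X \<and> v \<notin> set h \<and> (\<forall>u\<in>X. (u, v) \<in> P \<and> u \<noteq> v \<longrightarrow> u \<in> set h)"

definition legal_play :: "'a set \<Rightarrow> 'a rel \<Rightarrow> 'a list \<Rightarrow> bool" where
  "legal_play X P h \<longleftrightarrow> (\<forall>i<length h. legal_move X P (take i h) (h ! i))"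

definition claimed :: "player \<Rightarrow> player \<Rightarrow> 'a list \<Rightarrow> 'a set" where
  "claimed s q h = {h ! i | i. i < length h \<and> mover s i = q}"

definition winner :: "player \<Rightarrow> 'a set set \<Rightarrow> 'a list \<Rightarrow> player" where
  "winner s F h =
     (if \<exists>i\<le>length h. \<exists>W\<in>F. W \<subseteq> claimed s Maker (take i h) then Maker else Breaker)"

definition consistent_with :: "player \<Rightarrow> player \<Rightarrow> ('a list \<Rightarrow> 'a) \<Rightarrow> 'a list \<Rightarrow> bool" where
  "consistent_with s q \<sigma> h \<longleftrightarrow> (\<forall>i<length h. mover s i = q \<longrightarrow> h ! i = \<sigma> (take i h))"

text \<open>A strategy must prescribe a legal move whenever its owner is to move; otherwise an illegal
  prescription would make the second condition vacuous.\<close>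

definition winning_strategy ::
  "player \<Rightarrow> 'a set \<Rightarrow> 'a set set \<Rightarrow> 'a rel \<Rightarrow> player \<Rightarrow> ('a list \<Rightarrow> 'a) \<Rightarrow> bool" where
  "winning_strategy s X F P q \<sigma> \<longleftrightarrow>
     (\<forall>h. legal_play X P h \<and> consistent_with s q \<sigma> h \<and> set h \<noteq> X \<and> mover s (length h) = q
        \<longrightarrow> legal_move X P h (\<sigma> h)) \<and>
     (\<forall>h. legal_play X P h \<and> consistent_with s q \<sigma> h \<and> set h = X \<longrightarrow> winner s F h = q)"

definition has_winning_strategy ::
  "player \<Rightarrow> 'a set \<Rightarrow> 'a set set \<Rightarrow> 'a rel \<Rightarrow> player \<Rightarrow> bool" where
  "has_winning_strategy s X F P q \<longleftrightarrow> (\<exists>\<sigma>. winning_strategy s X F P q \<sigma>)"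


section \<open>Random access machine programs\<close>

text \<open>Structured programs over a random access machine: a state consists of registers and of a
  memory, both indexed by, and containing, natural numbers; the memory can be addressed indirectly.
  The only arithmetic operations are addition and truncated subtraction, and every node of an
  evaluated expression and every executed command is charged one unit. Hence word lengths grow by
  only a constant per time unit, and polynomial time in this sense coincides with polynomial time
  on Turing machines (multiplication, which would break this for unit costs, is absent).\<close>

datatype expr = Const nat | Reg nat | Mem expr | Plus expr expr | Minus expr expr

datatype com =
    Skip
  | Assign nat expr
  | Store expr expr
  | Seq com com
  | IfNZ expr com com
  | WhileNZ expr com

type_synonym state = "(nat \<Rightarrow> nat) \<times> (nat \<Rightarrow> nat)"

primrec eval_expr :: "state \<Rightarrow> expr \<Rightarrow> nat" where
  "eval_expr s (Const k) = k"
| "eval_expr s (Reg r) = fst s r"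
| "eval_expr s (Mem a) = snd s (eval_expr s a)"
| "eval_expr s (Plus a b) = eval_expr s a + eval_expr s b"
| "eval_expr s (Minus a b) = eval_expr s a - eval_expr s b"

primrec expr_cost :: "expr \<Rightarrow> nat" where
  "expr_cost (Const k) = 1"
| "expr_cost (Reg r) = 1"
| "expr_cost (Mem a) = 1 + expr_cost a"
| "expr_cost (Plus a b) = 1 + expr_cost a + expr_cost b"
| "expr_cost (Minus a b) = 1 + expr_cost a + expr_cost b"

text \<open>\<open>exec c s t s'\<close>: started in \<open>s\<close>, the program \<open>c\<close> halts in \<open>s'\<close> after \<open>t\<close> time units.\<close>

inductive exec :: "com \<Rightarrow> state \<Rightarrow> nat \<Rightarrow> state \<Rightarrow> bool" where
  Skip: "exec Skip s 1 s"
| Assign: "exec (Assign r a) s (1 + expr_cost a) ((fst s)(r := eval_expr s a), snd s)"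
| Store: "exec (Store a b) s (1 + expr_cost a + expr_cost b)
            (fst s, (snd s)(eval_expr s a := eval_expr s b))"
| Seq: "exec c1 s t1 s' \<Longrightarrow> exec c2 s' t2 s'' \<Longrightarrow> exec (Seq c1 c2) s (1 + t1 + t2) s''"
| IfTrue: "eval_expr s a \<noteq> 0 \<Longrightarrow> exec c1 s t s' \<Longrightarrow>
            exec (IfNZ a c1 c2) s (1 + expr_cost a + t) s'"
| IfFalse: "eval_expr s a = 0 \<Longrightarrow> exec c2 s t s' \<Longrightarrow>
            exec (IfNZ a c1 c2) s (1 + expr_cost a + t) s'"
| WhileTrue: "eval_expr s a \<noteq> 0 \<Longrightarrow> exec c s t1 s' \<Longrightarrow> exec (WhileNZ a c) s' t2 s'' \<Longrightarrow>
            exec (WhileNZ a c) s (1 + expr_cost a + t1 + t2) s''"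
| WhileFalse: "eval_expr s a = 0 \<Longrightarrow> exec (WhileNZ a c) s (1 + expr_cost a) s"

inductive_cases Skip_cases: "exec Skip s t s'"
inductive_cases Assign_cases: "exec (Assign r a) s t s'"
inductive_cases Store_cases: "exec (Store a b) s t s'"
inductive_cases Seq_cases: "exec (Seq c1 c2) s t s'"
inductive_cases IfNZ_cases: "exec (IfNZ a c1 c2) s t s'"
inductive_cases WhileNZ_cases: "exec (WhileNZ a c) s t s'"

lemma exec_deterministic: "exec c s t s1 \<Longrightarrow> exec c s u s2 \<Longrightarrow> u = t \<and> s2 = s1"
proof (induction arbitrary: u s2 rule: exec.induct)
  case (Skip s)
  then show ?case by (elim Skip_cases) simp
next
  case (Assign r a s)
  then show ?case by (elim Assign_cases) simp
next
  case (Store a b s)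
  then show ?case by (elim Store_cases) simp
next
  case (Seq c1 s t1 s' c2 t2 s'')
  from Seq.prems obtain u1 r u2
    where "u = 1 + u1 + u2" and "exec c1 s u1 r" and "exec c2 r u2 s2"
    by (elim Seq_cases) auto
  with Seq.IH(1)[of u1 r] Seq.IH(2)[of u2 s2] show ?case by simp
next
  case (IfTrue s a c1 t s' c2)
  from IfTrue.prems show ?case by (elim IfNZ_cases) (use IfTrue.hyps in \<open>simp_all add: IfTrue.IH\<close>)
next
  case (IfFalse s a c2 t s' c1)
  from IfFalse.prems show ?case by (elim IfNZ_cases) (use IfFalse.hyps in \<open>simp_all add: IfFalse.IH\<close>)
next
  case (WhileTrue s a c t1 s' t2 s'')
  from WhileTrue.prems obtain u1 r u2
    where "u = 1 + expr_cost a + u1 + u2" and "exec c s u1 r" and "exec (WhileNZ a c) r u2 s2"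
    by (rule WhileNZ_cases) (use WhileTrue.hyps in simp_all)
  with WhileTrue.IH(1)[of u1 r] WhileTrue.IH(2)[of u2 s2] show ?case by simp
next
  case (WhileFalse s a c)
  from WhileFalse.prems show ?case by (rule WhileNZ_cases) (use WhileFalse.hyps in simp_all)
qed

text \<open>The input is stored in the first memory cells and its length in register \<open>0\<close>, where the
  output is found as well; all other registers and cells initially contain \<open>0\<close>.\<close>

definition initial_state :: "nat list \<Rightarrow> state" where
  "initial_state inp =
     ((\<lambda>_. 0)(0 := length inp), (\<lambda>i. if i < length inp then inp ! i else 0))"

definition computes :: "com \<Rightarrow> nat list \<Rightarrow> nat \<Rightarrow> nat \<Rightarrow> bool" where
  "computes p inp t out \<longleftrightarrow> (\<exists>s. exec p (initial_state inp) t s \<and> fst s 0 = out)"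


section \<open>Encoding of games\<close>

text \<open>A game is presented by the number of vertices, the matrix of the order, the number of
  winning sets, and the incidence matrix of the winning sets against the vertices (both matrices
  row by row), for an arbitrary enumeration of the vertices and of the winning sets. All entries
  other than the two sizes are bits.\<close>

definition encode_game :: "'a list \<Rightarrow> 'a set list \<Rightarrow> 'a rel \<Rightarrow> nat list" where
  "encode_game xs Ws P =
     [length xs] @ [of_bool ((x, y) \<in> P). x \<leftarrow> xs, y \<leftarrow> xs] @
     [length Ws] @ [of_bool (x \<in> W). W \<leftarrow> Ws, x \<leftarrow> xs]"

definition encodes :: "nat list \<Rightarrow> 'a set \<Rightarrow> 'a set set \<Rightarrow> 'a rel \<Rightarrow> bool" where
  "encodes inp X F P \<longleftrightarrow>
     (\<exists>xs Ws. distinct xs \<and> set xs = X \<and> distinct Ws \<and> set Ws = F \<and> inp = encode_game xs Ws P)"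

primrec player_code :: "player \<Rightarrow> nat" where
  "player_code Maker = 1"
| "player_code Breaker = 0"

end

theory Submission
  imports Defs
begin

text \<open>If a minimal element is a winning set, Maker takes it at once; this happens iff there are more
  winning sets than non-minimal elements (\<open>tops\<close>). Otherwise the winning sets are exactly
  the tops, and Breaker has to claim every top. For a top \<open>y\<close> let \<open>L y\<close> (\<open>exclusive y\<close>) be the set
  of elements below \<open>y\<close> that lie below no other top, and \<open>D y\<close> (\<open>shared y\<close>) the set of the
  remaining elements below \<open>y\<close>.
  Maker wins iff \<open>|X|\<close> is odd or \<open>|L y| \<le> |D y|\<close> for some top \<open>y\<close>.

  Maker first exhausts \<open>L y\<close> in the second case, and then avoids making any top available. She gets
  stuck only when each unclaimed minimal element is the last one below some top; then the
  unclaimed tops outnumber the unclaimed minimal elements, by parity or because an element of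
  \<open>D y\<close> lies below a second top. From then on Breaker cannot keep up: each minimal element
  can free at most one top safely.

  Conversely, if \<open>|X|\<close> is even and \<open>|D y| < |L y|\<close> for all tops, Breaker maintains this: he answers a
  move that makes \<open>y\<close> available by claiming \<open>y\<close>, a move in \<open>L y\<close> by one in \<open>D y\<close> as long as
  the latter is not exhausted, and parity leaves him a harmless move in all other cases.\<close>

section \<open>Strategies from invariants\<close>

lemma legal_play_snoc:
  "legal_play X P (h @ [v]) \<longleftrightarrow> legal_play X P h \<and> legal_move X P h v"
  by (auto simp: legal_play_def nth_append less_Suc_eq)

lemma consistent_with_snoc:
  "consistent_with s q \<sigma> (h @ [v]) \<longleftrightarrow>
     consistent_with s q \<sigma> h \<and> (mover s (length h) = q \<longrightarrow> v = \<sigma> h)"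
  by (simp add: consistent_with_def All_less_Suc nth_append conj_commute)

lemma claimed_snoc:
  "claimed s q (h @ [v]) = claimed s q h \<union> (if mover s (length h) = q then {v} else {})"
  by (force simp: claimed_def nth_append less_Suc_eq)

lemma claimed_take_subset: "claimed s q (take i h) \<subseteq> claimed s q h"
  by (auto simp: claimed_def)

lemma winner_eq_Maker_iff:
  "winner s F h = Maker \<longleftrightarrow> (\<exists>W\<in>F. W \<subseteq> claimed s Maker h)"
proof
  assume "winner s F h = Maker"
  then obtain i W where "W \<in> F" "W \<subseteq> claimed s Maker (take i h)"
    by (auto simp: winner_def split: if_splits)
  then show "\<exists>W\<in>F. W \<subseteq> claimed s Maker h"
    using claimed_take_subset[of s Maker i h] by blast
next
  assume "\<exists>W\<in>F. W \<subseteq> claimed s Maker h"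
  then have "\<exists>i\<le>length h. \<exists>W\<in>F. W \<subseteq> claimed s Maker (take i h)"
    by (intro exI[of _ "length h"]) simp
  then show "winner s F h = Maker" by (simp add: winner_def)
qed

lemma legal_play_distinct: "legal_play X P h \<Longrightarrow> distinct h \<and> set h \<subseteq> X"
  by (induction h rule: rev_induct) (auto simp: legal_play_snoc legal_move_def)

text \<open>The strategy picks by choice any legal move that preserves \<open>I\<close>. Its values
  at positions violating \<open>I\<close> are arbitrary, which is harmless: by induction no
  consistent play leaves \<open>I\<close>. What remains of the game is a check of single
  moves.\<close>

lemma has_winning_strategyI:
  assumes start: "I []"
    and own: "\<And>h. I h \<Longrightarrow> legal_play X P h \<Longrightarrow> set h \<noteq> X \<Longrightarrow> mover s (length h) = q \<Longrightarrow>
                \<exists>v. legal_move X P h v \<and> I (h @ [v])"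
    and other: "\<And>h v. I h \<Longrightarrow> mover s (length h) \<noteq> q \<Longrightarrow> legal_move X P h v \<Longrightarrow> I (h @ [v])"
    and final: "\<And>h. I h \<Longrightarrow> set h = X \<Longrightarrow> winner s F h = q"
  shows "has_winning_strategy s X F P q"
proof -
  define \<sigma> where "\<sigma> h = (SOME v. legal_move X P h v \<and> I (h @ [v]))" for h
  have \<sigma>: "legal_move X P h (\<sigma> h) \<and> I (h @ [\<sigma> h])"
    if "I h" "legal_play X P h" "set h \<noteq> X" "mover s (length h) = q" for h
    unfolding \<sigma>_def by (rule someI_ex) (rule own[OF that])
  have inv: "I h" if "legal_play X P h" "consistent_with s q \<sigma> h" for h
    using that
  proof (induction h rule: rev_induct)
    case Nil
    show ?case by (rule start)
  next
    case (snoc v h)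
    then have h: "I h" and v: "legal_move X P h v"
      by (auto simp: legal_play_snoc consistent_with_snoc)
    show ?case
    proof (cases "mover s (length h) = q")
      case True
      moreover have "set h \<noteq> X" using v by (auto simp: legal_move_def)
      ultimately show ?thesis using \<sigma>[OF h] snoc.prems
        by (simp add: consistent_with_snoc legal_play_snoc)
    next
      case False
      then show ?thesis using other h v by blast
    qed
  qed
  then show ?thesis
    unfolding has_winning_strategy_def winning_strategy_def using \<sigma> final by blast
qed

text \<open>Playing the two strategies against each other yields a legal play of length
  \<open>card X\<close>. Its vertices are distinct, so it fills the board and would be won by both.
  This supplies the converse directions of the characterisation.\<close>

lemma not_both_winning:
  assumes "finite X" "has_winning_strategy s X F P Maker" "has_winning_strategy s X F P Breaker"
  shows False
proof -
  obtain \<sigma> \<tau> where \<sigma>: "winning_strategy s X F P Maker \<sigma>" and \<tau>: "winning_strategy s X F P Breaker \<tau>"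
    using assms by (auto simp: has_winning_strategy_def)
  let ?G = "\<lambda>h. legal_play X P h \<and> consistent_with s Maker \<sigma> h \<and> consistent_with s Breaker \<tau> h"
  have "\<exists>h. ?G h \<and> length h = k" if "k \<le> card X" for k
    using that
  proof (induction k)
    case 0
    show ?case by (simp add: legal_play_def consistent_with_def)
  next
    case (Suc k)
    then obtain h where h: "?G h" "length h = k" by auto
    have "set h \<noteq> X" using Suc.prems h(2) card_length[of h] by auto
    have "\<exists>v. ?G (h @ [v])"
    proof (cases "mover s (length h)")
      case Maker
      then have "legal_move X P h (\<sigma> h)"
        using \<sigma> h(1) \<open>set h \<noteq> X\<close> unfolding winning_strategy_def by blast
      then show ?thesis using h(1) Maker by (auto simp: legal_play_snoc consistent_with_snoc)
    next
      case Breaker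
      then have "legal_move X P h (\<tau> h)"
        using \<tau> h(1) \<open>set h \<noteq> X\<close> unfolding winning_strategy_def by blast
      then show ?thesis using h(1) Breaker by (auto simp: legal_play_snoc consistent_with_snoc)
    qed
    then obtain v where "?G (h @ [v])" ..
    moreover have "length (h @ [v]) = Suc k" using h(2) by simp
    ultimately show ?case by blast
  qed
  then obtain h where h: "?G h" "length h = card X" by blast
  then have "distinct h" "set h \<subseteq> X" using legal_play_distinct by blast+
  then have "set h = X"
    using h(2) by (intro card_subset_eq[OF assms(1)]) (simp_all add: distinct_card)
  then have "winner s F h = Maker" "winner s F h = Breaker"
    using h(1) \<sigma> \<tau> unfolding winning_strategy_def by blast+
  then show False by simp
qed

section \<open>Posets of height two\<close>

lemma card_Diff_insert_Suc:
  assumes "finite A" "v \<in> A - C"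
  shows "card (A - C) = Suc (card (A - insert v C))"
proof -
  have "A - C = insert v (A - insert v C)" using assms by auto
  then show ?thesis using assms(1) by (metis Diff_iff card_insert_disjoint finite_Diff insertI1)
qed

text \<open>The height bound enters the analysis of the game only as the absence of a strict chain
  of three elements.\<close>

locale two_level_poset =
  fixes X :: "'a set" and P :: "'a rel"
  assumes finite_X: "finite X"
    and two_levels: "\<And>x y z. \<lbrakk>x \<in> X; y \<in> X; z \<in> X; (z, x) \<in> P; (x, y) \<in> P\<rbrakk> \<Longrightarrow> z = x \<or> x = y"
begin

definition below :: "'a \<Rightarrow> 'a set" where
  "below y = {x \<in> X. (x, y) \<in> P \<and> x \<noteq> y}"

definition above :: "'a \<Rightarrow> 'a set" where
  "above x = {y \<in> X. (x, y) \<in> P \<and> x \<noteq> y}"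

definition tops :: "'a set" where
  "tops = {y \<in> X. below y \<noteq> {}}"

definition exclusive :: "'a \<Rightarrow> 'a set" where
  "exclusive y = {x \<in> below y. card (above x) = 1}"

definition shared :: "'a \<Rightarrow> 'a set" where
  "shared y = {x \<in> below y. card (above x) \<ge> 2}"

definition down_closed :: "'a set \<Rightarrow> bool" where
  "down_closed C \<longleftrightarrow> C \<subseteq> X \<and> (\<forall>y\<in>C. below y \<subseteq> C)"

definition playable :: "'a set \<Rightarrow> 'a \<Rightarrow> bool" where
  "playable C v \<longleftrightarrow> v \<in> X - C \<and> below v \<subseteq> C"

lemma legal_move_iff: "legal_move X P h v \<longleftrightarrow> playable (set h) v"
  by (auto simp: legal_move_def playable_def below_def)

lemma minimal_iff: "minimal_element X P y \<longleftrightarrow> y \<in> X - tops"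
  by (auto simp: minimal_element_def tops_def below_def)

lemma tops_subset: "tops \<subseteq> X" by (auto simp: tops_def)

lemma below_top_minimal: "x \<in> below y \<Longrightarrow> y \<in> X \<Longrightarrow> x \<in> X - tops"
  using two_levels by (fastforce simp: below_def tops_def)

lemma mem_above_iff: "x \<in> X \<Longrightarrow> y \<in> X \<Longrightarrow> y \<in> above x \<longleftrightarrow> x \<in> below y"
  by (auto simp: below_def above_def)

lemma above_subset_tops: "x \<in> X \<Longrightarrow> above x \<subseteq> tops"
  by (auto simp: below_def above_def tops_def)

lemma below_subset: "below y \<subseteq> X" by (auto simp: below_def)

lemma finite_below [simp]: "finite (below y)" "finite (above y)"
  using finite_X by (auto simp: below_def above_def)

lemma finite_exclusive [simp]: "finite (exclusive y)" "finite (shared y)"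
  by (auto simp: exclusive_def shared_def)

lemma finite_tops [simp]: "finite tops"
  using finite_X tops_subset finite_subset by blast

text \<open>\<open>y\<close> itself lies above each element of \<open>below y\<close>, so
  \<open>card (above x)\<close> is never \<open>0\<close> there and the two classes exhaust
  it.\<close>

lemma below_eq: "y \<in> X \<Longrightarrow> below y = exclusive y \<union> shared y"
proof -
  assume y: "y \<in> X"
  have "card (above x) \<ge> 1" if "x \<in> below y" for x
  proof -
    have "y \<in> above x" using that y below_subset mem_above_iff by blast
    then show ?thesis by (metis One_nat_def Suc_leI card_gt_0_iff empty_iff finite_below(2))
  qed
  then show ?thesis by (force simp: exclusive_def shared_def)
qed

lemma exclusive_shared_disjoint: "exclusive y \<inter> shared z = {}"
  by (auto simp: exclusive_def shared_def)

lemma exclusive_unique: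
  assumes "x \<in> exclusive y" "x \<in> below z" "y \<in> X" "z \<in> X"
  shows "z = y"
proof -
  have "y \<in> above x" "z \<in> above x" using assms below_subset mem_above_iff
    by (auto simp: exclusive_def)
  moreover from assms obtain a where "above x = {a}" by (auto simp: exclusive_def card_1_singleton_iff)
  ultimately show ?thesis by auto
qed

lemma playable_minimal: "v \<in> X - tops - C \<Longrightarrow> playable C v"
  by (auto simp: playable_def tops_def)

lemma down_closed_insert: "down_closed C \<Longrightarrow> playable C v \<Longrightarrow> down_closed (insert v C)"
  by (auto simp: down_closed_def playable_def)

lemma card_unclaimed: "card (X - C) = card (X - tops - C) + card (tops - C)"
proof -
  have "X - C = (X - tops - C) \<union> (tops - C)" using tops_subset by auto
  also have "card \<dots> = card (X - tops - C) + card (tops - C)"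
    using finite_X by (intro card_Un_disjoint) auto
  finally show ?thesis .
qed

lemma legal_play_down_closed: "legal_play X P h \<Longrightarrow> down_closed (set h)"
proof (induction h rule: rev_induct)
  case Nil
  show ?case by (simp add: down_closed_def)
next
  case (snoc v h)
  then show ?case using down_closed_insert by (simp add: legal_play_snoc legal_move_iff)
qed

text \<open>An unclaimed minimal element can always be taken; if none is left, everything below an
  unclaimed top is claimed. Maker needs this to continue legally after she has already won.\<close>

lemma playable_exists:
  assumes "down_closed C" "C \<noteq> X"
  shows "\<exists>v. playable C v"
proof (cases "X - tops - C = {}")
  case True
  then have "tops - C \<noteq> {}" using assms by (auto simp: down_closed_def)
  then obtain y where y: "y \<in> tops - C" by blast
  have "below y \<subseteq> C" using True y below_top_minimal[of _ y] tops_subset by blast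
  then show ?thesis using y tops_subset by (auto simp: playable_def)
next
  case False
  then show ?thesis using playable_minimal by blast
qed

section \<open>Maker's strategy\<close>

text \<open>Here Maker is to move. Besides an immediate win, the alternatives are a shortage of
  minimal elements, parity, and a top whose exclusive part she can exhaust. The first conjunct
  matters because an odd number of unclaimed vertices is worthless once all tops are gone.\<close>

definition maker_ahead :: "'a set \<Rightarrow> bool" where
  "maker_ahead C \<longleftrightarrow> tops - C \<noteq> {} \<and>
     ((\<exists>y\<in>tops. playable C y) \<or> card (X - tops - C) < card (tops - C) \<or> odd (card (X - C)) \<or>
      (\<exists>y\<in>tops - C. card (exclusive y - C) \<le> card (shared y - C)))"

definition maker_good :: "'a set \<Rightarrow> bool" where
  "maker_good C \<longleftrightarrow> down_closed C \<and> maker_ahead C"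

text \<open>Here Breaker is to move. The first conjunct keeps the full board from being lost
  vacuously.\<close>

definition breaker_lost :: "'a set \<Rightarrow> bool" where
  "breaker_lost C \<longleftrightarrow> C \<noteq> X \<and> (\<forall>w. playable C w \<longrightarrow> maker_good (insert w C))"

text \<open>Send each unclaimed minimal element to a top for which it is the last unclaimed element
  below. This map is injective, as the top determines the element, and by \<open>le\<close> it is
  onto. Hence every unclaimed top has its own single unclaimed element below.\<close>

lemma tops_left_bijective:
  assumes blocked: "\<And>v. v \<in> X - tops - C \<Longrightarrow> \<exists>y\<in>tops - C. below y - C = {v}"
    and le: "\<not> card (X - tops - C) < card (tops - C)"
  shows "card (X - tops - C) = card (tops - C)"
    and "\<And>y z v. y \<in> tops - C \<Longrightarrow> z \<in> tops - C \<Longrightarrow> v \<in> below y - C \<Longrightarrow> v \<in> below z - C \<Longrightarrow> y = z"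
proof -
  from blocked obtain g where g: "\<And>v. v \<in> X - tops - C \<Longrightarrow> g v \<in> tops - C \<and> below (g v) - C = {v}"
    by metis
  have inj: "inj_on g (X - tops - C)"
    by (rule inj_onI) (metis g singleton_inject)
  have img: "g ` (X - tops - C) \<subseteq> tops - C" using g by blast
  have "card (g ` (X - tops - C)) = card (X - tops - C)" by (rule card_image[OF inj])
  moreover have "card (g ` (X - tops - C)) \<le> card (tops - C)" using img by (simp add: card_mono)
  ultimately show eq: "card (X - tops - C) = card (tops - C)" using le by simp
  have surj: "g ` (X - tops - C) = tops - C"
    using img eq card_image[OF inj] by (intro card_subset_eq) auto
  fix y z v
  assume "y \<in> tops - C" "z \<in> tops - C" "v \<in> below y - C" "v \<in> below z - C"
  then show "y = z" using surj g by (smt (verit) imageE singletonD)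
qed

text \<open>If no top can be taken, Maker claims a minimal element: an arbitrary one if the tops
  already outnumber the minimal elements, one from \<open>exclusive e\<close> while that is not
  exhausted, and otherwise one that makes no top available.\<close>

lemma maker_good_move:
  assumes "maker_good C"
  shows "\<exists>v. playable C v \<and> (v \<in> tops \<or> breaker_lost (insert v C))"
proof (cases "\<exists>y\<in>tops. playable C y")
  case True
  then show ?thesis by blast
next
  case False
  have C: "down_closed C" "C \<subseteq> X" using assms by (auto simp: maker_good_def down_closed_def)
  have unfinished: "below y - C \<noteq> {}" if "y \<in> tops - C" for y
    using that False by (auto simp: playable_def tops_def)
  obtain y0 where y0: "y0 \<in> tops - C" using assms by (auto simp: maker_good_def maker_ahead_def)
  \<comment> \<open>For a minimal \<open>v\<close> only \<open>maker_ahead\<close> after Breaker's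
    answer has to be checked: down-closure persists, and \<open>y0\<close> is still unclaimed, so
    the board is not full.\<close>
  have reply: "\<exists>v. playable C v \<and> breaker_lost (insert v C)"
    if v: "v \<in> X - tops - C"
      and ahead: "\<And>w. playable (insert v C) w \<Longrightarrow> maker_ahead (insert w (insert v C))"
    for v
  proof (intro exI conjI)
    show pv: "playable C v" using playable_minimal v by simp
    have "y0 \<notin> insert v C" using y0 v by auto
    then show "breaker_lost (insert v C)"
      using ahead y0 tops_subset down_closed_insert[OF down_closed_insert[OF C(1) pv]]
      unfolding breaker_lost_def maker_good_def by auto
  qed
  \<comment> \<open>A top with \<open>exclusive e\<close> exhausted falls under
    \<open>quiet\<close>: there the inequality between the two cardinalities is automatic and stays
    true whatever is claimed.\<close>
  consider (few) "card (X - tops - C) < card (tops - C)"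
    | (edge) e where "e \<in> tops - C" "card (exclusive e - C) \<le> card (shared e - C)" "exclusive e - C \<noteq> {}"
    | (quiet) "\<not> card (X - tops - C) < card (tops - C)"
        "odd (card (X - C)) \<or> (\<exists>e\<in>tops - C. exclusive e - C = {})"
    using assms False unfolding maker_good_def maker_ahead_def by blast
  then have "\<exists>v. playable C v \<and> breaker_lost (insert v C)"
  proof cases
    case few
    obtain v where v: "v \<in> X - tops - C"
      using unfinished[OF y0] y0 below_top_minimal tops_subset by blast
    show ?thesis
    proof (rule reply[OF v])
      fix w assume w: "playable (insert v C) w"
      have r: "card (X - tops - C) = Suc (card (X - tops - insert v C))"
        using card_Diff_insert_Suc[OF finite_Diff[OF finite_X] v] .
      have "card (X - tops - insert w (insert v C)) \<le> card (X - tops - insert v C)"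
        using finite_X by (intro card_mono) auto
      moreover have "card (tops - C) \<le> Suc (card (tops - insert w (insert v C)))"
      proof -
        have "tops - C \<subseteq> insert w (tops - insert w (insert v C))" using v by auto
        from card_mono[OF _ this] show ?thesis by (simp add: card_insert_if split: if_splits)
      qed
      ultimately have "card (X - tops - insert w (insert v C)) < card (tops - insert w (insert v C))"
        using r few by linarith
      moreover then have "tops - insert w (insert v C) \<noteq> {}" by force
      ultimately show "maker_ahead (insert w (insert v C))"
        unfolding maker_ahead_def by blast
    qed
  next
    case edge
    then obtain v where ve: "v \<in> exclusive e - C" by blast
    have eX: "e \<in> X" using edge tops_subset by blast
    have v: "v \<in> X - tops - C" using ve eX below_top_minimal by (auto simp: exclusive_def)
    have vs: "v \<notin> shared e" using ve exclusive_shared_disjoint by blast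
    have p: "card (exclusive e - C) = Suc (card (exclusive e - insert v C))"
      using card_Diff_insert_Suc[OF finite_exclusive(1) ve] .
    have s: "shared e - insert v C = shared e - C" using vs by auto
    show ?thesis
    proof (rule reply[OF v])
      fix w assume w: "playable (insert v C) w"
      \<comment> \<open>Some shared element still blocks \<open>e\<close>, so Breaker cannot answer
        by claiming \<open>e\<close> itself. He can only lower the shared count by one, which
        matches Maker's move.\<close>
      have "shared e - C \<noteq> {}" using p edge by force
      then have "\<not> below e \<subseteq> insert v C" using s by (auto simp: shared_def)
      then have "w \<noteq> e" using w by (auto simp: playable_def)
      moreover have "e \<noteq> v" using v edge by auto
      ultimately have e: "e \<in> tops - insert w (insert v C)" using edge by auto
      have "card (exclusive e - insert w (insert v C)) \<le> card (exclusive e - insert v C)"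
        by (intro card_mono) auto
      moreover have "card (shared e - insert v C) \<le> Suc (card (shared e - insert w (insert v C)))"
      proof -
        have "shared e - insert v C \<subseteq> insert w (shared e - insert w (insert v C))" by auto
        from card_mono[OF _ this] show ?thesis by (simp add: card_insert_if split: if_splits)
      qed
      ultimately have "card (exclusive e - insert w (insert v C)) \<le> card (shared e - insert w (insert v C))"
        using p s edge by simp
      then show "maker_ahead (insert w (insert v C))"
        using e unfolding maker_ahead_def by blast
    qed
  next
    case quiet
    have "\<exists>v\<in>X - tops - C. \<forall>y\<in>tops - C. below y - C \<noteq> {v}"
    proof (rule ccontr)
      assume "\<not> ?thesis"
      then have *: "\<And>v. v \<in> X - tops - C \<Longrightarrow> \<exists>y\<in>tops - C. below y - C = {v}" by blast
      note bij = tops_left_bijective[OF * quiet(1)]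
      have "even (card (X - C))" using bij(1) card_unclaimed[of C] by simp
      then obtain e where e: "e \<in> tops - C" "exclusive e - C = {}" using quiet by blast
      then have eX: "e \<in> X" using tops_subset by blast
      obtain v where v: "v \<in> shared e - C" using unfinished[OF e(1)] below_eq[OF eX] e(2) by auto
      then have vX: "v \<in> X" "v \<in> below e" "card (above v) \<ge> 2"
        using below_subset by (auto simp: shared_def)
      \<comment> \<open>By down-closure all tops above \<open>v\<close> are unclaimed, and under the
        bijection distinct unclaimed tops share no unclaimed element below. So \<open>e\<close> is
        the only one, although \<open>v\<close> is shared.\<close>
      have "above v \<subseteq> {e}"
      proof
        fix z assume z: "z \<in> above v"
        then have zt: "z \<in> tops" "z \<in> X" using above_subset_tops vX tops_subset by blast+
        then have vz: "v \<in> below z" using z mem_above_iff vX by blast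
        then have "z \<notin> C" using C(1) v by (auto simp: down_closed_def)
        then show "z \<in> {e}" using bij(2)[of z e v] zt vz v e vX by auto
      qed
      then have "card (above v) \<le> card {e}" by (intro card_mono) auto
      then show False using vX by simp
    qed
    then obtain v where v: "v \<in> X - tops - C" and free: "\<And>y. y \<in> tops - C \<Longrightarrow> below y - C \<noteq> {v}"
      by blast
    show ?thesis
    proof (rule reply[OF v])
      fix w assume w: "playable (insert v C) w"
      \<comment> \<open>No top was available before, and \<open>v\<close> is not the last element
        below any; so Breaker must answer with a minimal element.\<close>
      have wt: "w \<notin> tops"
      proof
        assume "w \<in> tops"
        then have "w \<in> tops - C" "below w - C \<subseteq> {v}" using w by (auto simp: playable_def)
        then show False using free[of w] unfinished[of w] by blast
      qed
      have T: "tops - insert w (insert v C) = tops - C" using wt v by auto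
      have "card (X - C) = Suc (card (X - insert v C))" using v by (intro card_Diff_insert_Suc[OF finite_X]) auto
      moreover have "card (X - insert v C) = Suc (card (X - insert w (insert v C)))"
        using w by (intro card_Diff_insert_Suc[OF finite_X]) (auto simp: playable_def)
      ultimately have "odd (card (X - insert w (insert v C))) \<longleftrightarrow> odd (card (X - C))" by simp
      moreover have "exclusive e - insert w (insert v C) = {}" if "exclusive e - C = {}" for e
        using that by auto
      ultimately have "odd (card (X - insert w (insert v C))) \<or>
         (\<exists>y\<in>tops - insert w (insert v C).
            card (exclusive y - insert w (insert v C)) \<le> card (shared y - insert w (insert v C)))"
        using quiet(2) unfolding T by (metis card.empty le0)
      moreover have "tops - insert w (insert v C) \<noteq> {}" using y0 wt T by auto
      ultimately show "maker_ahead (insert w (insert v C))"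
        unfolding maker_ahead_def by blast
    qed
  qed
  then show ?thesis by blast
qed

lemma mover_Maker: "mover Maker i = (if even i then Maker else Breaker)"
  by (simp add: mover_def)

text \<open>The invariant alternates with the parity of the play until Maker has won. Neither
  alternative holds on the full board, so she must have won by then.\<close>

lemma maker_wins_by_good:
  assumes F: "\<And>y. y \<in> tops \<Longrightarrow> {y} \<in> F" and good: "maker_good {}"
  shows "has_winning_strategy Maker X F P Maker"
proof -
  define won where "won h \<longleftrightarrow> (\<exists>W\<in>F. W \<subseteq> claimed Maker Maker h)" for h
  define I where
    "I h \<longleftrightarrow> won h \<or> (if even (length h) then maker_good (set h) else breaker_lost (set h))" for h
  have won_snoc: "won (h @ [v])" if "won h" for h v
    using that unfolding won_def claimed_snoc by blast
  show ?thesis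
  proof (rule has_winning_strategyI[of I])
    show "I []" using good by (simp add: I_def)
    show "\<exists>v. legal_move X P h v \<and> I (h @ [v])"
      if h: "I h" "legal_play X P h" "set h \<noteq> X" "mover Maker (length h) = Maker" for h
    proof (cases "won h")
      case True
      have "down_closed (set h)" using h(2) legal_play_down_closed by blast
      then obtain v where "playable (set h) v" using playable_exists h(3) by blast
      then show ?thesis using won_snoc[OF True] unfolding legal_move_iff I_def by blast
    next
      case False
      have ev: "even (length h)" using h(4) by (simp add: mover_Maker split: if_splits)
      then have "maker_good (set h)" using h(1) False by (simp add: I_def)
      then obtain v where v: "playable (set h) v" "v \<in> tops \<or> breaker_lost (insert v (set h))"
        using maker_good_move by blast
      have "I (h @ [v])"
      proof (cases "v \<in> tops")
        case True
        have "v \<in> claimed Maker Maker (h @ [v])" using h(4) by (simp add: claimed_snoc)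
        then have "won (h @ [v])" unfolding won_def by (intro bexI[OF _ F[OF True]]) simp
        then show ?thesis by (simp add: I_def)
      next
        case False
        then show ?thesis using v(2) ev by (simp add: I_def)
      qed
      then show ?thesis using v(1) legal_move_iff by blast
    qed
    show "I (h @ [v])" if h: "I h" "mover Maker (length h) \<noteq> Maker" "legal_move X P h v" for h v
    proof (cases "won h")
      case True
      then show ?thesis using won_snoc by (simp add: I_def)
    next
      case False
      have "odd (length h)" using h(2) by (simp add: mover_Maker split: if_splits)
      then show ?thesis using h(1,3) False by (simp add: I_def breaker_lost_def legal_move_iff)
    qed
    show "winner Maker F h = Maker" if "I h" "set h = X" for h
    proof -
      have "\<not> maker_good X" "\<not> breaker_lost X"
        using tops_subset by (auto simp: maker_good_def maker_ahead_def breaker_lost_def)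
      then have "won h" using that by (simp add: I_def split: if_splits)
      then show ?thesis by (simp add: winner_eq_Maker_iff won_def)
    qed
  qed
qed

lemma maker_wins_at_once:
  assumes v: "v \<in> X - tops" "{v} \<in> F"
  shows "has_winning_strategy Maker X F P Maker"
proof -
  define I where "I h \<longleftrightarrow> h = [] \<or> v \<in> claimed Maker Maker h" for h
  have I_snoc: "I (h @ [u])" if "v \<in> claimed Maker Maker h" for h u
    using that by (simp add: I_def claimed_snoc)
  show ?thesis
  proof (rule has_winning_strategyI[of I])
    show "I []" by (simp add: I_def)
    show "\<exists>u. legal_move X P h u \<and> I (h @ [u])"
      if h: "I h" "legal_play X P h" "set h \<noteq> X" for h
    proof (cases "h = []")
      case True
      have "v \<in> claimed Maker Maker ([] @ [v])" unfolding claimed_snoc by (simp add: mover_Maker)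
      then show ?thesis using v(1) playable_minimal[of v "{}"] True
        unfolding legal_move_iff I_def by auto
    next
      case False
      have "down_closed (set h)" using h(2) legal_play_down_closed by blast
      then obtain u where "playable (set h) u" using playable_exists h(3) by blast
      then show ?thesis using h(1) False I_snoc unfolding legal_move_iff I_def by blast
    qed
    show "I (h @ [u])" if h: "I h" "mover Maker (length h) \<noteq> Maker" for h u
      using h I_snoc by (cases "h = []") (auto simp: I_def mover_Maker)
    show "winner Maker F h = Maker" if "I h" "set h = X" for h
    proof -
      have "h \<noteq> []" using that(2) v(1) by auto
      then have "{v} \<subseteq> claimed Maker Maker h" using that(1) by (simp add: I_def)
      then show ?thesis unfolding winner_eq_Maker_iff using v(2) by blast
    qed
  qed
qed

section \<open>Breaker's strategy\<close>

text \<open>Here Maker is to move. The strict inequality leaves an unclaimed exclusive element below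
  every unclaimed top, so Maker can take no top now.\<close>

definition breaker_good :: "'a set \<Rightarrow> bool" where
  "breaker_good C \<longleftrightarrow> down_closed C \<and> even (card (X - C)) \<and>
     (\<forall>y\<in>tops - C. card (shared y - C) < card (exclusive y - C))"

lemma exclusive_subset_below: "exclusive y \<subseteq> below y"
  by (auto simp: exclusive_def)

lemma breaker_good_exclusive_left:
  assumes "breaker_good C" "y \<in> tops - C"
  shows "exclusive y - C \<noteq> {}"
proof -
  have "0 < card (exclusive y - C)" using assms by (force simp: breaker_good_def)
  then show ?thesis by (simp add: card_gt_0_iff)
qed

lemma breaker_good_blocks_tops: "breaker_good C \<Longrightarrow> playable C v \<Longrightarrow> v \<notin> tops"
  using breaker_good_exclusive_left[of C v] exclusive_subset_below[of v]
  by (auto simp: playable_def)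

text \<open>Breaker takes a top that has become available; else he answers a move in
  \<open>exclusive e\<close> within \<open>shared e\<close>; else he takes a minimal element that is
  exclusive to no top; and if there is none, parity provides a top with an exclusive element to
  spare.\<close>

lemma breaker_good_reply:
  assumes good: "breaker_good C" and v: "playable C v"
  shows "\<exists>w. playable (insert v C) w \<and> breaker_good (insert w (insert v C))"
proof -
  have C: "down_closed C" "even (card (X - C))"
    and less: "\<And>y. y \<in> tops - C \<Longrightarrow> card (shared y - C) < card (exclusive y - C)"
    using good by (auto simp: breaker_good_def)
  note ne = breaker_good_exclusive_left[OF good] and excl_below = exclusive_subset_below
  have vt: "v \<notin> tops" using breaker_good_blocks_tops[OF good v] .
  have vX: "v \<in> X - tops - C" using v vt by (auto simp: playable_def)
  let ?C = "insert v C"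
  have odd: "odd (card (X - ?C))" using card_Diff_insert_Suc[OF finite_X, of v C] vX C(2) by simp
  have T: "tops - ?C = tops - C" using vX by auto
  have reply: ?thesis
    if w: "playable ?C w"
      and less': "\<And>y. y \<in> tops - C \<Longrightarrow> y \<noteq> w \<Longrightarrow>
        card (shared y - insert w ?C) < card (exclusive y - insert w ?C)" for w
  proof -
    have "even (card (X - insert w ?C))"
      using card_Diff_insert_Suc[OF finite_X, of w ?C] odd w by (simp add: playable_def)
    then have "breaker_good (insert w ?C)"
      using less' down_closed_insert[OF down_closed_insert[OF C(1) v] w] T
      by (auto simp: breaker_good_def)
    then show ?thesis using w by blast
  qed
  have shared_mono: "card (shared y - A) \<le> card (shared y - B)" if "B \<subseteq> A" for y A B
    using that by (intro card_mono) auto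
  show ?thesis
  proof (cases "\<exists>y\<in>tops. playable ?C y")
    case True
    then obtain y where y: "y \<in> tops" "playable ?C y" ..
    then have yC: "y \<in> tops - C" "below y - C \<subseteq> {v}" by (auto simp: playable_def)
    \<comment> \<open>An exclusive element below \<open>y\<close> was still unclaimed, and only
      \<open>v\<close> can be it. Hence the exchange of \<open>v\<close> and \<open>y\<close>
      affects no other top.\<close>
    then have vy: "v \<in> exclusive y" using ne[of y] excl_below[of y] by blast
    show ?thesis
    proof (rule reply[OF y(2)])
      fix e assume e: "e \<in> tops - C" "e \<noteq> y"
      have "v \<notin> below e" using exclusive_unique[OF vy] e y(1) tops_subset by blast
      moreover have "y \<notin> below e" using below_top_minimal[of y e] e y(1) tops_subset by blast
      ultimately have "shared e - insert y ?C = shared e - C" "exclusive e - insert y ?C = exclusive e - C"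
        by (auto simp: shared_def exclusive_def)
      then show "card (shared e - insert y ?C) < card (exclusive e - insert y ?C)"
        using less e by simp
    qed
  next
    case nofree: False
    show ?thesis
    proof (cases "\<exists>e\<in>tops - C. v \<in> exclusive e \<and> shared e - C \<noteq> {}")
      case True
      then obtain e w where e: "e \<in> tops - C" "v \<in> exclusive e" and w: "w \<in> shared e - C" by blast
      have eX: "e \<in> X" using e tops_subset by blast
      have wX: "w \<in> X - tops - ?C"
        using w below_top_minimal[OF _ eX, of w] e(2) exclusive_shared_disjoint[of e e]
        by (auto simp: shared_def)
      show ?thesis
      proof (rule reply[OF playable_minimal[OF wX]])
        fix y assume y: "y \<in> tops - C" "y \<noteq> w"
        have wy: "w \<notin> exclusive y" using w exclusive_shared_disjoint by blast
        show "card (shared y - insert w ?C) < card (exclusive y - insert w ?C)"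
        proof (cases "y = e")
          case True
          have "exclusive e - insert w ?C = exclusive e - ?C" using wy True by auto
          then have 1: "card (exclusive e - C) = Suc (card (exclusive e - insert w ?C))"
            using card_Diff_insert_Suc[of "exclusive e" v C] e(2) vX by simp
          have "v \<notin> shared e" using e(2) exclusive_shared_disjoint by blast
          then have "shared e - insert w ?C = shared e - insert w C" by auto
          then have "card (shared e - C) = Suc (card (shared e - insert w ?C))"
            using card_Diff_insert_Suc[of "shared e" w C] w by simp
          then show ?thesis using 1 less[OF e(1)] True by simp
        next
          case False
          then have "v \<notin> below y" using exclusive_unique[OF e(2)] eX y tops_subset by blast
          then have "exclusive y - insert w ?C = exclusive y - C"
            using wy by (auto simp: exclusive_def)
          then show ?thesis
            using le_less_trans[OF shared_mono[of C "insert w ?C" y] less[OF y(1)]] by auto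
        qed
      qed
    next
      case False
      \<comment> \<open>Every answer \<open>w\<close> that spares the exclusive parts is now
        harmless. If \<open>v\<close> was exclusive to \<open>y\<close>, then
        \<open>shared y\<close> is exhausted and \<open>y\<close>, not being available, has an
        exclusive element left; otherwise only the shared side has shrunk.\<close>
      have left: "card (shared y - insert w ?C) < card (exclusive y - ?C)" if "y \<in> tops - C" for y w
      proof (cases "v \<in> exclusive y")
        case True
        then have s: "shared y - C = {}" using False that by blast
        have "\<not> below y \<subseteq> ?C" using nofree that T by (auto simp: playable_def tops_def)
        then have "exclusive y - ?C \<noteq> {}" using below_eq[of y] s that tops_subset by blast
        then have "0 < card (exclusive y - ?C)" by (subst card_gt_0_iff) simp
        moreover have "shared y - insert w ?C = {}" using s by auto
        ultimately show ?thesis by (simp only: card.empty)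
      next
        case False
        then have "exclusive y - ?C = exclusive y - C" by auto
        then show ?thesis
          using le_less_trans[OF shared_mono[of C "insert w ?C" y] less[OF that]] by auto
      qed
      show ?thesis
      proof (cases "\<exists>w\<in>X - tops - ?C. card (above w) \<noteq> 1")
        case True
        \<comment> \<open>Such a \<open>w\<close> lies below no top or below at least two, hence in
          no exclusive part.\<close>
        then obtain w where w: "w \<in> X - tops - ?C" "card (above w) \<noteq> 1" by blast
        show ?thesis
        proof (rule reply[OF playable_minimal[OF w(1)]])
          fix y assume y: "y \<in> tops - C" "y \<noteq> w"
          have "exclusive y - insert w ?C = exclusive y - ?C" using w(2) by (auto simp: exclusive_def)
          then show "card (shared y - insert w ?C) < card (exclusive y - insert w ?C)"
            using left[OF y(1)] by simp
        qed
      next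
        case single: False
        have no_shared: "shared y - ?C = {}" if "y \<in> tops - C" for y
        proof (rule equals0I)
          fix x assume x: "x \<in> shared y - ?C"
          then have "x \<in> X - tops - ?C"
            using that below_top_minimal[of x y] tops_subset unfolding shared_def by blast
          then have "card (above x) = 1" using single by blast
          then show False using x by (simp add: shared_def)
        qed
        have cover: "\<exists>y\<in>tops - C. w \<in> exclusive y" if w: "w \<in> X - tops - ?C" for w
        proof -
          have 1: "card (above w) = 1" using single w by blast
          then obtain y where "above w = {y}" by (auto simp: card_1_singleton_iff)
          then have y: "y \<in> above w" by simp
          have wX: "w \<in> X" using w by blast
          have yt: "y \<in> tops" using above_subset_tops[OF wX] y by blast
          then have wy: "w \<in> below y" using mem_above_iff[OF wX, of y] y tops_subset by blast
          then have "y \<notin> C" using C(1) w unfolding down_closed_def by blast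
          then show ?thesis using yt wy 1 unfolding exclusive_def by blast
        qed
        \<comment> \<open>The exclusive parts of the unclaimed tops now partition the unclaimed
          minimal elements. If all were singletons, there would be as many minimal elements as tops
          left, contradicting that \<open>card (X - ?C)\<close> is odd.\<close>
        have "\<exists>f\<in>tops - C. card (exclusive f - ?C) \<noteq> 1"
        proof (rule ccontr)
          assume "\<not> ?thesis"
          then have one: "card (exclusive f - ?C) = 1" if "f \<in> tops - C" for f using that by blast
          have "exclusive f \<subseteq> X - tops" if "f \<in> tops" for f
            using that excl_below[of f] below_top_minimal[of _ f] tops_subset by blast
          then have "X - tops - ?C = (\<Union>f\<in>tops - C. exclusive f - ?C)" using cover by blast
          also have "card \<dots> = (\<Sum>f\<in>tops - C. card (exclusive f - ?C))"
          proof (rule card_UN_disjoint)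
            show "\<forall>f\<in>tops - C. \<forall>g\<in>tops - C. f \<noteq> g \<longrightarrow>
                (exclusive f - ?C) \<inter> (exclusive g - ?C) = {}"
            proof (intro ballI impI equals0I)
              fix f g x
              assume "f \<in> tops - C" "g \<in> tops - C" "f \<noteq> g"
                and x: "x \<in> (exclusive f - ?C) \<inter> (exclusive g - ?C)"
              moreover have "x \<in> exclusive f" "x \<in> below g" using x excl_below[of g] by auto
              ultimately show False using exclusive_unique[of x f g] tops_subset by blast
            qed
          qed simp_all
          also have "\<dots> = card (tops - C)" using one by simp
          finally have "card (X - ?C) = 2 * card (tops - C)" using card_unclaimed[of ?C] T by simp
          then show False using odd by simp
        qed
        then obtain f where f: "f \<in> tops - C" "card (exclusive f - ?C) \<noteq> 1" by blast
        \<comment> \<open>Using \<open>left\<close> with \<open>v\<close> inserted twice shows that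
          the cardinality is positive.\<close>
        then have two: "card (exclusive f - ?C) \<ge> 2" using left[OF f(1), of v] by linarith
        then have "exclusive f - ?C \<noteq> {}" by (metis card.empty not_numeral_le_zero)
        then obtain w where w: "w \<in> exclusive f - ?C" by blast
        have fX: "f \<in> X" using f tops_subset by blast
        have wX: "w \<in> X - tops - ?C" using w below_top_minimal[OF _ fX, of w] excl_below by blast
        show ?thesis
        proof (rule reply[OF playable_minimal[OF wX]])
          fix y assume y: "y \<in> tops - C" "y \<noteq> w"
          have s: "shared y - insert w ?C = {}" using no_shared[OF y(1)] by auto
          show "card (shared y - insert w ?C) < card (exclusive y - insert w ?C)"
          proof (cases "y = f")
            case True
            have "card (exclusive f - ?C) = Suc (card (exclusive f - insert w ?C))"
              using card_Diff_insert_Suc[OF finite_exclusive(1) w] .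
            then have "0 < card (exclusive f - insert w ?C)" using two by linarith
            then show ?thesis using s True by (simp only: card.empty)
          next
            case False
            then have "w \<notin> exclusive y"
              using exclusive_unique[of w f y] w fX y tops_subset excl_below by blast
            then have "exclusive y - insert w ?C = exclusive y - ?C" by auto
            then show ?thesis using left[OF y(1)] by simp
          qed
        qed
      qed
    qed
  qed
qed

text \<open>After a move of Maker the invariant already records that a good answer exists; it also
  records that she has claimed no top.\<close>

lemma breaker_wins_by_good:
  assumes F: "\<And>W. W \<in> F \<Longrightarrow> \<exists>y\<in>tops. W = {y}" and good: "breaker_good {}"
  shows "has_winning_strategy Maker X F P Breaker"
proof (rule has_winning_strategyI)
  let ?I = "\<lambda>h. claimed Maker Maker h \<inter> tops = {} \<and>
    (if even (length h) then breaker_good (set h)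
     else \<exists>w. playable (set h) w \<and> breaker_good (insert w (set h)))"
  show "?I []" using good by (simp add: claimed_def)
  show "\<exists>v. legal_move X P h v \<and> ?I (h @ [v])"
    if "?I h" "mover Maker (length h) = Breaker" for h
    using that by (auto simp: legal_move_iff mover_Maker claimed_snoc split: if_splits)
  show "?I (h @ [v])" if "?I h" "mover Maker (length h) \<noteq> Breaker" "legal_move X P h v" for h v
    using that breaker_good_reply[of "set h" v] breaker_good_blocks_tops[of "set h" v]
    by (auto simp: legal_move_iff mover_Maker claimed_snoc split: if_splits)
  show "winner Maker F h = Breaker" if "?I h" for h
  proof -
    have "winner Maker F h \<noteq> Maker" using that F by (fastforce simp: winner_eq_Maker_iff)
    then show ?thesis by (cases "winner Maker F h") auto
  qed
qed

section \<open>The characterisation\<close>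

text \<open>For singleton families containing all \<open>{y}\<close> with \<open>y\<close> a top,
  the first disjunct says that some minimal element wins by itself. As a comparison of two numbers
  it suits the program.\<close>

definition maker_criterion :: "'a set set \<Rightarrow> bool" where
  "maker_criterion F \<longleftrightarrow> card F \<noteq> card tops \<or> odd (card X) \<or>
     (\<exists>y\<in>tops. card (exclusive y) \<le> card (shared y))"

lemma winning_strategy_iff_criterion:
  assumes tops: "tops \<noteq> {}" and F: "F \<subseteq> Pow X" "\<And>W. W \<in> F \<Longrightarrow> card W = 1" "\<And>y. y \<in> tops \<Longrightarrow> {y} \<in> F"
  shows "has_winning_strategy Maker X F P Maker \<longleftrightarrow> maker_criterion F"
    and "has_winning_strategy Maker X F P Breaker \<longleftrightarrow> \<not> maker_criterion F"
proof -
  have sub: "(\<lambda>y. {y}) ` tops \<subseteq> F" using F(3) by blast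
  have card_img: "card ((\<lambda>y. {y}) ` tops) = card tops" by (simp add: card_image)
  have "finite F" using F(1) finite_X by (simp add: finite_subset)
  have yes: "has_winning_strategy Maker X F P Maker" if "maker_criterion F"
  proof (cases "card F = card tops")
    case True
    then have "maker_good {}"
      using that tops by (auto simp: maker_criterion_def maker_good_def maker_ahead_def down_closed_def)
    then show ?thesis using maker_wins_by_good F(3) by blast
  next
    case False
    then have "F \<noteq> (\<lambda>y. {y}) ` tops" using card_img by metis
    then obtain W where W: "W \<in> F" "W \<notin> (\<lambda>y. {y}) ` tops" using sub by blast
    then obtain v where "W = {v}" using F(2) by (metis card_1_singletonE)
    then show ?thesis using W F(1) maker_wins_at_once[of v F] by blast
  qed
  have no: "has_winning_strategy Maker X F P Breaker" if "\<not> maker_criterion F"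
  proof (rule breaker_wins_by_good)
    have "F = (\<lambda>y. {y}) ` tops"
      using that card_subset_eq[OF \<open>finite F\<close> sub] card_img by (simp add: maker_criterion_def)
    then show "\<exists>y\<in>tops. W = {y}" if "W \<in> F" for W using that by blast
    show "breaker_good {}"
      using that by (auto simp: maker_criterion_def breaker_good_def down_closed_def)
  qed
  show "has_winning_strategy Maker X F P Maker \<longleftrightarrow> maker_criterion F"
    "has_winning_strategy Maker X F P Breaker \<longleftrightarrow> \<not> maker_criterion F"
    using yes no not_both_winning[OF finite_X] by blast+
qed

end

section \<open>Timed Hoare triples for programs that do not write to memory\<close>

definition triple ::
  "(nat \<Rightarrow> nat) \<Rightarrow> ((nat \<Rightarrow> nat) \<Rightarrow> bool) \<Rightarrow> com \<Rightarrow> nat \<Rightarrow> ((nat \<Rightarrow> nat) \<Rightarrow> bool) \<Rightarrow> bool" where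
  "triple m A c T B \<longleftrightarrow> (\<forall>R. A R \<longrightarrow> (\<exists>t R'. exec c (R, m) t (R', m) \<and> t \<le> T \<and> B R'))"

lemma triple_conseq:
  "triple m A' c T' B \<Longrightarrow> (\<And>R. A R \<Longrightarrow> A' R) \<Longrightarrow> T' \<le> T \<Longrightarrow> triple m A c T B"
  unfolding triple_def by (meson order_trans)

lemma triple_Skip: "triple m B Skip 1 B"
  unfolding triple_def by (meson exec.Skip order_refl)

lemma triple_Assign:
  "triple m (\<lambda>R. B (R(r := eval_expr (R, m) a))) (Assign r a) (1 + expr_cost a) B"
  unfolding triple_def using exec.Assign[of r a "(R, m)" for R] by fastforce

text \<open>The second command comes first among the premises: in backward reasoning its
  precondition instantiates the middle assertion \<open>B\<close>.\<close>

lemma triple_Seq: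
  assumes "triple m B c2 T2 C" "triple m A c1 T1 B"
  shows "triple m A (Seq c1 c2) (1 + T1 + T2) C"
  unfolding triple_def
proof (intro allI impI)
  fix R assume "A R"
  then obtain t1 R1 where 1: "exec c1 (R, m) t1 (R1, m)" "t1 \<le> T1" "B R1"
    using assms(2) unfolding triple_def by blast
  then obtain t2 R2 where 2: "exec c2 (R1, m) t2 (R2, m)" "t2 \<le> T2" "C R2"
    using assms(1) unfolding triple_def by blast
  show "\<exists>t R'. exec (Seq c1 c2) (R, m) t (R', m) \<and> t \<le> 1 + T1 + T2 \<and> C R'"
    using exec.Seq[OF 1(1) 2(1)] 1(2) 2(2,3)
    by (intro exI[of _ "1 + t1 + t2"] exI[of _ R2]) simp
qed

text \<open>Adding the two branch bounds instead of taking their maximum keeps the time bounds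
  purely additive.\<close>

lemma triple_IfNZ:
  assumes "triple m A1 c1 T1 B" "triple m A2 c2 T2 B"
  shows "triple m (\<lambda>R. if eval_expr (R, m) a \<noteq> 0 then A1 R else A2 R)
           (IfNZ a c1 c2) (1 + expr_cost a + (T1 + T2)) B"
  unfolding triple_def
proof (intro allI impI)
  fix R assume A: "if eval_expr (R, m) a \<noteq> 0 then A1 R else A2 R"
  show "\<exists>t R'. exec (IfNZ a c1 c2) (R, m) t (R', m) \<and> t \<le> 1 + expr_cost a + (T1 + T2) \<and> B R'"
  proof (cases "eval_expr (R, m) a = 0")
    case True
    then obtain t R' where "exec c2 (R, m) t (R', m)" "t \<le> T2" "B R'"
      using A assms(2) unfolding triple_def by auto
    then show ?thesis using exec.IfFalse[OF True] by fastforce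
  next
    case False
    then obtain t R' where "exec c1 (R, m) t (R', m)" "t \<le> T1" "B R'"
      using A assms(1) unfolding triple_def by auto
    then show ?thesis using exec.IfTrue[OF False] by fastforce
  qed
qed

text \<open>The loop bound is read from memory cell \<open>0\<close>, where the encoding of a game stores the number
  of vertices.\<close>

definition for_loop :: "nat \<Rightarrow> com \<Rightarrow> com" where
  "for_loop r body = Seq (Assign r (Const 0))
     (WhileNZ (Minus (Mem (Const 0)) (Reg r)) (Seq body (Assign r (Plus (Reg r) (Const 1)))))"

text \<open>By \<open>indep\<close> the invariant survives changes of the counter. Beyond the body a
  round costs \<open>5\<close> for the test and \<open>5\<close> for sequencing and increment; the
  \<open>8\<close> consists of the last test and an initialisation costing \<open>3\<close>.\<close>

lemma triple_for_loop:
  assumes body: "\<And>i. i < m 0 \<Longrightarrow>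
      triple m (\<lambda>R. I i R \<and> R r = i) body T (\<lambda>R. I (Suc i) R \<and> R r = i)"
    and indep: "\<And>i k R. I i (R(r := k)) = I i R"
  shows "triple m (I 0) (for_loop r body) (m 0 * (T + 10) + 8) (I (m 0))"
proof -
  let ?e = "Minus (Mem (Const 0)) (Reg r)"
  let ?b = "Seq body (Assign r (Plus (Reg r) (Const 1)))"
  have loop: "\<exists>t R'. exec (WhileNZ ?e ?b) (R, m) t (R', m) \<and> t \<le> d * (T + 10) + 5 \<and> I (m 0) R'"
    if "I i R" "R r = i" "i + d = m 0" for d i R
    using that
  proof (induction d arbitrary: i R)
    case 0
    then have "eval_expr (R, m) ?e = 0" by simp
    then show ?case using exec.WhileFalse[of "(R, m)" ?e ?b] 0 by fastforce
  next
    case (Suc d)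
    then obtain t1 R1 where 1: "exec body (R, m) t1 (R1, m)" "t1 \<le> T" "I (Suc i) R1" "R1 r = i"
      using body[of i] unfolding triple_def by auto
    have b: "exec ?b (R, m) (1 + t1 + 4) (R1(r := Suc i), m)"
      using exec.Seq[OF 1(1) exec.Assign[of r "Plus (Reg r) (Const 1)"]] 1(4)
      by (simp add: eval_nat_numeral)
    have "I (Suc i) (R1(r := Suc i))" using 1(3) by (simp only: indep)
    then obtain t2 R2 where 2: "exec (WhileNZ ?e ?b) (R1(r := Suc i), m) t2 (R2, m)"
        "t2 \<le> d * (T + 10) + 5" "I (m 0) R2"
      using Suc.IH[of "Suc i" "R1(r := Suc i)"] Suc.prems(3) by (metis add_Suc_shift fun_upd_same)
    have "eval_expr (R, m) ?e \<noteq> 0" using Suc.prems by simp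
    from exec.WhileTrue[OF this b 2(1)] show ?case using 1(2) 2(2,3) by fastforce
  qed
  show ?thesis
    unfolding triple_def
  proof (intro allI impI)
    fix R assume "I 0 R"
    then have "I 0 (R(r := 0))" by (simp only: indep)
    then obtain t R' where w: "exec (WhileNZ ?e ?b) (R(r := 0), m) t (R', m)"
        "t \<le> m 0 * (T + 10) + 5" "I (m 0) R'"
      using loop[of 0 "R(r := 0)" "m 0"] by (metis add_0 fun_upd_same)
    have "exec (for_loop r body) (R, m) (1 + 2 + t) (R', m)"
      unfolding for_loop_def using exec.Seq[OF exec.Assign[of r "Const 0" "(R, m)"]] w(1) by simp
    then show "\<exists>t R'. exec (for_loop r body) (R, m) t (R', m) \<and> t \<le> m 0 * (T + 10) + 8 \<and> I (m 0) R'"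
      using w(2,3) by fastforce
  qed
qed

section \<open>The program\<close>

text \<open>Memory cell \<open>0\<close> holds the number \<open>n\<close> of vertices, the order matrix starts in cell \<open>1\<close>, and
  the number of winning sets is found in cell \<open>1 + n * n\<close>.\<close>

definition matrix_entry :: "(nat \<Rightarrow> nat) \<Rightarrow> nat \<Rightarrow> nat \<Rightarrow> bool" where
  "matrix_entry m x y \<longleftrightarrow> m (1 + x * m 0 + y) \<noteq> 0"

definition row_sum :: "(nat \<Rightarrow> nat) \<Rightarrow> nat \<Rightarrow> nat" where
  "row_sum m x = (\<Sum>z<m 0. m (1 + x * m 0 + z))"

definition column_count :: "(nat \<Rightarrow> nat) \<Rightarrow> (nat \<Rightarrow> bool) \<Rightarrow> nat \<Rightarrow> nat \<Rightarrow> nat" where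
  "column_count m Q y i = (\<Sum>x<i. of_bool (matrix_entry m x y \<and> Q (row_sum m x)))"

text \<open>By reflexivity, the row sum of an element and the column count of an element both include the
  element itself: a row sum of \<open>2\<close> means exactly one element above, and a column count of at
  least \<open>2\<close> means that the element is not minimal.\<close>

abbreviation "below_count m y \<equiv> column_count m (\<lambda>_. True) y"
abbreviation "exclusive_count m y \<equiv> column_count m (\<lambda>k. k = 2) y"
abbreviation "shared_count m y \<equiv> column_count m (\<lambda>k. 2 < k) y"

definition top_count :: "(nat \<Rightarrow> nat) \<Rightarrow> nat \<Rightarrow> nat" where
  "top_count m i = (\<Sum>y<i. of_bool (2 \<le> below_count m y (m 0)))"

lemma column_count_simps [simp]:
  "column_count m Q y 0 = 0"
  "column_count m Q y (Suc i) =
     column_count m Q y i + of_bool (matrix_entry m i y \<and> Q (row_sum m i))"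
  by (simp_all only: column_count_def lessThan_0 sum.empty sum.lessThan_Suc)

lemma top_count_simps [simp]:
  "top_count m 0 = 0"
  "top_count m (Suc i) = top_count m i + of_bool (2 \<le> below_count m i (m 0))"
  by (simp_all only: top_count_def lessThan_0 sum.empty sum.lessThan_Suc)

definition bad_top_before :: "(nat \<Rightarrow> nat) \<Rightarrow> nat \<Rightarrow> bool" where
  "bad_top_before m i \<longleftrightarrow> (\<exists>y<i. 2 \<le> below_count m y (m 0) \<and>
     exclusive_count m y (m 0) \<le> shared_count m y (m 0))"

lemma bad_top_before_simps [simp]:
  "\<not> bad_top_before m 0"
  "bad_top_before m (Suc i) \<longleftrightarrow> bad_top_before m i \<or> 2 \<le> below_count m i (m 0) \<and>
     exclusive_count m i (m 0) \<le> shared_count m i (m 0)"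
  by (auto simp: bad_top_before_def less_Suc_eq)

text \<open>Registers: \<open>1\<close> column \<open>y\<close>, \<open>2\<close> row \<open>x\<close>, \<open>3\<close> position in the row, \<open>4\<close> address of the row,
  \<open>5\<close> row sum, \<open>6\<close>, \<open>7\<close>, \<open>8\<close> the three counts of the column, \<open>9\<close> whether a bad top was found,
  \<open>10\<close> number of tops, \<open>11\<close> parity.\<close>

definition incr :: "nat \<Rightarrow> com" where
  "incr r = Assign r (Plus (Reg r) (Const 1))"

definition sum_row :: com where
  "sum_row = for_loop 3 (Assign 5 (Plus (Reg 5) (Mem (Plus (Reg 4) (Reg 3)))))"

text \<open>Without multiplication the row address has to be advanced by addition. The row sum is
  recomputed for every entry, whence the cubic running time. In the inner branch, a row sum that
  exceeds \<open>1\<close> but not \<open>2\<close> equals \<open>2\<close>.\<close>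

definition process_entry :: com where
  "process_entry =
     Seq (Assign 5 (Const 0)) (Seq sum_row (Seq
       (IfNZ (Mem (Plus (Reg 4) (Reg 1)))
         (Seq (incr 6)
           (IfNZ (Minus (Reg 5) (Const 2)) (incr 8) (IfNZ (Minus (Reg 5) (Const 1)) (incr 7) Skip)))
         Skip)
       (Assign 4 (Plus (Reg 4) (Mem (Const 0))))))"

text \<open>Truncated subtraction serves as comparison: \<open>Minus (Reg 7) (Reg 8)\<close>
  vanishes iff the exclusive count is at most the shared one. Register \<open>11\<close> is toggled
  once per column and thus yields the parity of the number of vertices.\<close>

definition process_column :: com where
  "process_column =
     Seq (Assign 4 (Const 1)) (Seq (Assign 6 (Const 0)) (Seq (Assign 7 (Const 0))
       (Seq (Assign 8 (Const 0)) (Seq (for_loop 2 process_entry) (Seq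
         (IfNZ (Minus (Reg 6) (Const 1))
           (Seq (incr 10) (IfNZ (Minus (Reg 7) (Reg 8)) Skip (Assign 9 (Const 1))))
           Skip)
         (Assign 11 (Minus (Const 1) (Reg 11))))))))"

text \<open>After the last column register \<open>4\<close> points just behind the order matrix, at
  the number of winning sets. The sum of the three tests acts as their disjunction.\<close>

definition game_program :: com where
  "game_program = Seq (for_loop 1 process_column)
     (IfNZ (Plus (Minus (Mem (Reg 4)) (Reg 10)) (Plus (Reg 11) (Reg 9)))
       (Assign 0 (Const 1)) (Assign 0 (Const 0)))"

section \<open>Loop invariants and running times\<close>

lemma triple_incr: "triple m (\<lambda>R. B (R(r := Suc (R r)))) (incr r) 4 B"
  using triple_Assign[of m B r "Plus (Reg r) (Const 1)"] by (simp add: incr_def eval_nat_numeral)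

lemmas triple_rules = triple_Skip triple_incr triple_Assign triple_IfNZ triple_Seq

text \<open>\<open>G\<close> is an arbitrary frame assertion on registers that the loop preserves;
  it omits the counter \<open>3\<close> and the accumulator \<open>5\<close>.\<close>

lemma triple_sum_row:
  "triple m (\<lambda>R. G (R 1) (R 2) (R 4) (R 6) (R 7) (R 8) (R 9) (R 10) (R 11) \<and> R 5 = 0 \<and> R 4 = p)
     sum_row (17 * m 0 + 8)
     (\<lambda>R. G (R 1) (R 2) (R 4) (R 6) (R 7) (R 8) (R 9) (R 10) (R 11) \<and> R 5 = (\<Sum>z<m 0. m (p + z)) \<and> R 4 = p)"
proof -
  define I where "I i R \<longleftrightarrow> G (R 1) (R 2) (R 4) (R 6) (R 7) (R 8) (R 9) (R 10) (R 11)
    \<and> R 5 = (\<Sum>z<i. m (p + z)) \<and> R 4 = p" for i :: nat and R :: "nat \<Rightarrow> nat"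
  have "triple m (I 0) sum_row (m 0 * (7 + 10) + 8) (I (m 0))"
    unfolding sum_row_def
  proof (rule triple_for_loop)
    show "triple m (\<lambda>R. I i R \<and> R 3 = i) (Assign 5 (Plus (Reg 5) (Mem (Plus (Reg 4) (Reg 3))))) 7
        (\<lambda>R. I (Suc i) R \<and> R 3 = i)" for i
      by (rule triple_conseq, rule triple_Assign) (auto simp: I_def)
  qed (simp add: I_def)
  then show ?thesis by (simp add: I_def[abs_def] mult.commute)
qed

lemma triple_process_entry:
  fixes m :: "nat \<Rightarrow> nat" and y f k a :: nat
  defines "I \<equiv> \<lambda>i (R :: nat \<Rightarrow> nat). R 1 = y \<and> R 4 = 1 + i * m 0 \<and> R 6 = below_count m y i \<and>
    R 7 = exclusive_count m y i \<and> R 8 = shared_count m y i \<and> R 9 = f \<and> R 10 = k \<and> R 11 = a"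
  shows "triple m (\<lambda>R. I i R \<and> R 2 = i) process_entry (17 * m 0 + 60)
      (\<lambda>R. I (Suc i) R \<and> R 2 = i)"
proof -
  define G where "G r1 r2 r4 r6 r7 r8 r9 r10 r11 \<longleftrightarrow> r1 = y \<and> r2 = i \<and> r4 = 1 + i * m 0 \<and>
    r6 = below_count m y i \<and> r7 = exclusive_count m y i \<and> r8 = shared_count m y i \<and>
    r9 = f \<and> r10 = k \<and> r11 = a" for r1 r2 r4 r6 r7 r8 r9 r10 r11
  let ?p = "1 + i * m 0"
  let ?B = "\<lambda>R. G (R 1) (R 2) (R 4) (R 6) (R 7) (R 8) (R 9) (R 10) (R 11) \<and>
    R 5 = row_sum m i \<and> R 4 = ?p"
  have tail: "triple m ?B (Seq
       (IfNZ (Mem (Plus (Reg 4) (Reg 1)))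
         (Seq (incr 6)
           (IfNZ (Minus (Reg 5) (Const 2)) (incr 8) (IfNZ (Minus (Reg 5) (Const 1)) (incr 7) Skip)))
         Skip)
       (Assign 4 (Plus (Reg 4) (Mem (Const 0))))) 40 (\<lambda>R. I (Suc i) R \<and> R 2 = i)"
    by (rule triple_conseq, (rule triple_rules)+)
      (auto simp: I_def G_def matrix_entry_def)
  have head: "triple m (\<lambda>R. I i R \<and> R 2 = i) (Assign 5 (Const 0)) 2
    (\<lambda>R. G (R 1) (R 2) (R 4) (R 6) (R 7) (R 8) (R 9) (R 10) (R 11) \<and> R 5 = 0 \<and> R 4 = ?p)"
    by (rule triple_conseq, rule triple_Assign) (auto simp: I_def G_def)
  show ?thesis
    unfolding process_entry_def
    by (rule triple_conseq, rule triple_Seq[OF triple_Seq[OF tail triple_sum_row[of m _ ?p, folded row_sum_def]] head])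
      simp_all
qed

text \<open>The clause on register \<open>4\<close> is conditional because the register is still
  \<open>0\<close> before the first column. It is needed for the final test, which is why the whole
  program is analysed for a nonempty board.\<close>

lemma triple_process_column:
  fixes m :: "nat \<Rightarrow> nat"
  defines "I \<equiv> \<lambda>i (R :: nat \<Rightarrow> nat). (0 < i \<longrightarrow> R 4 = 1 + m 0 * m 0) \<and> R 9 = of_bool (bad_top_before m i) \<and>
    R 10 = top_count m i \<and> R 11 = i mod 2"
  shows "triple m (\<lambda>R. I i R \<and> R 1 = i) process_column (m 0 * (17 * m 0 + 70) + 60)
      (\<lambda>R. I (Suc i) R \<and> R 1 = i)"
proof -
  define f k a :: nat where "f = of_bool (bad_top_before m i)" and "k = top_count m i" and "a = i mod 2"
  define J where "J \<equiv> \<lambda>j (R :: nat \<Rightarrow> nat). R 1 = i \<and> R 4 = 1 + j * m 0 \<and> R 6 = below_count m i j \<and>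
    R 7 = exclusive_count m i j \<and> R 8 = shared_count m i j \<and> R 9 = f \<and> R 10 = k \<and> R 11 = a"
  have loop: "triple m (J 0) (for_loop 2 process_entry) (m 0 * (17 * m 0 + 60 + 10) + 8) (J (m 0))"
    by (rule triple_for_loop) (unfold J_def, rule triple_process_entry, simp)
  have tail: "triple m (J (m 0)) (Seq
         (IfNZ (Minus (Reg 6) (Const 1))
           (Seq (incr 10) (IfNZ (Minus (Reg 7) (Reg 8)) Skip (Assign 9 (Const 1))))
           Skip)
         (Assign 11 (Minus (Const 1) (Reg 11)))) 30 (\<lambda>R. I (Suc i) R \<and> R 1 = i)"
    by (rule triple_conseq, (rule triple_rules)+)
      (auto simp: J_def I_def f_def k_def a_def mod_Suc)
  have inner: "triple m (J 0) (Seq (for_loop 2 process_entry) (Seq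
         (IfNZ (Minus (Reg 6) (Const 1))
           (Seq (incr 10) (IfNZ (Minus (Reg 7) (Reg 8)) Skip (Assign 9 (Const 1))))
           Skip)
         (Assign 11 (Minus (Const 1) (Reg 11))))) (m 0 * (17 * m 0 + 70) + 40)
      (\<lambda>R. I (Suc i) R \<and> R 1 = i)"
    by (rule triple_conseq, rule triple_Seq[OF tail loop]) (simp_all add: algebra_simps)
  show ?thesis
    unfolding process_column_def
    by (rule triple_conseq, rule triple_Seq, rule triple_Seq, rule triple_Seq, rule triple_Seq,
      rule inner, (rule triple_Assign)+)
      (auto simp: J_def I_def f_def k_def a_def)
qed

lemma triple_game_program:
  assumes "0 < m 0"
  shows "triple m (\<lambda>R. \<forall>r>0. R r = 0) game_program (100 * m 0 ^ 3 + 200 * m 0 ^ 2 + 200 * m 0 + 100)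
    (\<lambda>R. R 0 = of_bool (top_count m (m 0) < m (1 + m 0 * m 0) \<or> odd (m 0) \<or> bad_top_before m (m 0)))"
proof -
  define I where "I \<equiv> \<lambda>i (R :: nat \<Rightarrow> nat). (0 < i \<longrightarrow> R 4 = 1 + m 0 * m 0) \<and>
    R 9 = of_bool (bad_top_before m i) \<and> R 10 = top_count m i \<and> R 11 = i mod (2::nat)"
  have loop: "triple m (I 0) (for_loop 1 process_column)
      (m 0 * (m 0 * (17 * m 0 + 70) + 60 + 10) + 8) (I (m 0))"
    by (rule triple_for_loop) (unfold I_def, rule triple_process_column, simp)
  have tail: "triple m (I (m 0)) (IfNZ (Plus (Minus (Mem (Reg 4)) (Reg 10)) (Plus (Reg 11) (Reg 9)))
       (Assign 0 (Const 1)) (Assign 0 (Const 0))) 20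
    (\<lambda>R. R 0 = of_bool (top_count m (m 0) < m (1 + m 0 * m 0) \<or> odd (m 0) \<or> bad_top_before m (m 0)))"
    using assms
    by - (rule triple_conseq, (rule triple_rules)+, auto simp: I_def odd_iff_mod_2_eq_one)
  show ?thesis
    unfolding game_program_def
    by (rule triple_conseq, rule triple_Seq[OF tail loop])
      (auto simp: I_def algebra_simps power2_eq_square power3_eq_cube)
qed

section \<open>Correctness of the program\<close>

lemma nth_concat_map_uniform:
  assumes "\<And>x. length (f x) = k" "i < length xs" "j < k"
  shows "concat (map f xs) ! (i * k + j) = f (xs ! i) ! j"
  using assms(2)
proof (induction xs arbitrary: i)
  case Nil
  then show ?case by simp
next
  case (Cons x xs)
  then show ?case using assms(1,3) by (cases i) (auto simp: nth_append)
qed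

lemma length_concat_map_uniform:
  assumes "\<And>x. length (f x) = k"
  shows "length (concat (map f xs)) = length xs * k"
  using assms by (induction xs) auto

text \<open>The last claim guarantees that the addresses read lie within the input and not among the
  cells that are \<open>0\<close> by default.\<close>

lemma encode_game_nth:
  fixes xs :: "'a list" and Ws :: "'a set list" and P :: "'a rel"
  defines "inp \<equiv> encode_game xs Ws P" and "n \<equiv> length xs"
  shows "inp ! 0 = n"
    and "i < n \<Longrightarrow> j < n \<Longrightarrow> inp ! (1 + i * n + j) = of_bool ((xs ! i, xs ! j) \<in> P)"
    and "inp ! (1 + n * n) = length Ws"
    and "1 + n * n < length inp"
proof -
  let ?f = "\<lambda>x. map (\<lambda>y. of_bool ((x, y) \<in> P) :: nat) xs"
  have f: "length (?f x) = n" for x by (simp add: n_def)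
  define rest where "rest = concat (map (\<lambda>W. map (\<lambda>x. of_bool (x \<in> W) :: nat) xs) Ws)"
  have inp: "inp = n # (concat (map ?f xs) @ length Ws # rest)"
    by (simp add: inp_def n_def encode_game_def rest_def)
  have len: "length (concat (map ?f xs)) = n * n"
    using length_concat_map_uniform[of ?f n xs] f by (simp add: n_def)
  show "inp ! 0 = n" by (simp add: inp)
  show "inp ! (1 + i * n + j) = of_bool ((xs ! i, xs ! j) \<in> P)" if "i < n" "j < n"
  proof -
    have "Suc i * n \<le> n * n" using that(1) by (intro mult_le_mono1) simp
    then have "i * n + j < n * n" using that(2) by simp
    then have "inp ! (1 + i * n + j) = concat (map ?f xs) ! (i * n + j)"
      using len by (simp add: inp nth_append)
    also have "\<dots> = ?f (xs ! i) ! j"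
      using that by (intro nth_concat_map_uniform) (simp_all add: n_def)
    also have "\<dots> = of_bool ((xs ! i, xs ! j) \<in> P)" using that(2) by (simp add: n_def)
    finally show ?thesis .
  qed
  show "inp ! (1 + n * n) = length Ws"
    using nth_append_length[of "concat (map ?f xs)" "length Ws" rest] len by (simp add: inp)
  show "1 + n * n < length inp" using len by (simp add: inp)
qed

lemma sum_nth_eq_sum_set:
  "distinct xs \<Longrightarrow> (\<Sum>i<length xs. g (xs ! i)) = sum g (set xs)"
  by (rule sum.reindex_bij_betw) (simp add: bij_betw_nth)

section \<open>From height two to the two-level locale\<close>

text \<open>A strict chain \<open>z\<close>, \<open>x\<close>, \<open>y\<close> would have three
  elements, antisymmetry giving \<open>z \<noteq> y\<close>. Conversely, the larger element of a
  chain attaining the height is a top.\<close>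

lemma two_level_posetI:
  assumes "poset_game X F P" "poset_height P = 2"
  shows "two_level_poset X P" "two_level_poset.tops X P \<noteq> {}"
proof -
  have fin: "finite X" and sub: "P \<subseteq> X \<times> X" and refl: "refl_on X P" and trans: "trans P"
    and antisym: "antisym P"
    using assms(1) by (auto simp: poset_game_def partial_order_on_def preorder_on_def)
  have "Chains P \<subseteq> Pow X" using sub by (auto simp: Chains_def)
  then have finC: "finite (card ` Chains P)" using fin by (simp add: finite_subset)
  \<comment> \<open>The empty chain makes \<open>Max\<close> range over a nonempty set, so the
    maximum is attained.\<close>
  have "{} \<in> Chains P" by (simp add: Chains_def)
  then have neC: "card ` Chains P \<noteq> {}" by blast
  have le: "card C \<le> 2" if "C \<in> Chains P" for C
    using Max_ge[OF finC, of "card C"] that assms(2) by (simp add: poset_height_def)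
  show tl: "two_level_poset X P"
  proof
    show "finite X" by (rule fin)
    fix x y z
    assume xyz: "x \<in> X" "y \<in> X" "z \<in> X" "(z, x) \<in> P" "(x, y) \<in> P"
    show "z = x \<or> x = y"
    proof (rule ccontr)
      assume ne: "\<not> ?thesis"
      have zy: "(z, y) \<in> P" using trans xyz by (meson transD)
      have "z \<noteq> y" using ne xyz antisym by (auto dest: antisymD)
      moreover have "{z, x, y} \<in> Chains P"
        using xyz zy refl by (auto simp: Chains_def refl_on_def)
      ultimately show False using le[of "{z, x, y}"] ne by auto
    qed
  qed
  interpret two_level_poset X P by (rule tl)
  obtain C where C: "C \<in> Chains P" "card C = 2"
    using Max_in[OF finC neC] assms(2) by (auto simp: poset_height_def)
  then obtain a b where ab: "C = {a, b}" "a \<noteq> b" by (auto simp: card_2_iff)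
  then have "(a, b) \<in> P \<or> (b, a) \<in> P" using C by (auto simp: Chains_def)
  then show "tops \<noteq> {}" using ab sub by (auto simp: tops_def below_def)
qed

section \<open>Agreement of the computed counts with the poset\<close>

context two_level_poset
begin

lemma above_top: "y \<in> tops \<Longrightarrow> above y = {}"
proof (rule equals0I)
  fix z assume "y \<in> tops" "z \<in> above y"
  then show False
    using below_top_minimal[of y z] mem_above_iff[of y z] above_subset_tops[of y] tops_subset by blast
qed

lemma program_counts:
  fixes m :: "nat \<Rightarrow> nat" and xs :: "'a list"
  assumes refl: "refl_on X P" and xs: "distinct xs" "set xs = X"
    and size: "m 0 = length xs"
    and entry: "\<And>i j. i < length xs \<Longrightarrow> j < length xs \<Longrightarrow>
      m (1 + i * length xs + j) = of_bool ((xs ! i, xs ! j) \<in> P)"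
  shows "top_count m (m 0) = card tops"
    and "bad_top_before m (m 0) \<longleftrightarrow> (\<exists>y\<in>tops. card (exclusive y) \<le> card (shared y))"
proof -
  let ?n = "length xs"
  have inX: "xs ! i \<in> X" if "i < ?n" for i using that xs by auto
  have row: "row_sum m i = Suc (card (above (xs ! i)))" if i: "i < ?n" for i
  proof -
    have "row_sum m i = (\<Sum>j<?n. of_bool ((xs ! i, xs ! j) \<in> P))"
      unfolding row_sum_def size using entry[OF i] by (intro sum.cong) simp_all
    also have "\<dots> = (\<Sum>z\<in>X. of_bool ((xs ! i, z) \<in> P))"
      using sum_nth_eq_sum_set[OF xs(1), of "\<lambda>z. of_bool ((xs ! i, z) \<in> P)"] by (simp only: xs(2))
    also have "\<dots> = card {z \<in> X. (xs ! i, z) \<in> P}" using finite_X by (simp add: Int_def)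
    also have "{z \<in> X. (xs ! i, z) \<in> P} = insert (xs ! i) (above (xs ! i))"
      using refl inX[OF i] by (auto simp: above_def refl_on_def)
    also have "card \<dots> = Suc (card (above (xs ! i)))"
      by (rule card_insert_disjoint) (simp, simp add: above_def)
    finally show ?thesis .
  qed
  have column: "column_count m Q j ?n = card {x \<in> X. (x, xs ! j) \<in> P \<and> Q (Suc (card (above x)))}"
    if j: "j < ?n" for Q j
  proof -
    have "column_count m Q j ?n =
        (\<Sum>i<?n. of_bool ((xs ! i, xs ! j) \<in> P \<and> Q (Suc (card (above (xs ! i))))))"
      unfolding column_count_def matrix_entry_def size
      using entry[OF _ j] row by (intro sum.cong) simp_all
    also have "\<dots> = (\<Sum>x\<in>X. of_bool ((x, xs ! j) \<in> P \<and> Q (Suc (card (above x)))))"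
      using sum_nth_eq_sum_set[OF xs(1), of "\<lambda>x. of_bool ((x, xs ! j) \<in> P \<and> Q (Suc (card (above x))))"]
      by (simp only: xs(2))
    also have "\<dots> = card {x \<in> X. (x, xs ! j) \<in> P \<and> Q (Suc (card (above x)))}"
      using finite_X by (simp add: Int_def)
    finally show ?thesis .
  qed
  have below: "2 \<le> below_count m j ?n \<longleftrightarrow> xs ! j \<in> tops" if j: "j < ?n" for j
  proof -
    have "{x \<in> X. (x, xs ! j) \<in> P} = insert (xs ! j) (below (xs ! j))"
      using refl inX[OF j] by (auto simp: below_def refl_on_def)
    then have "below_count m j ?n = card (insert (xs ! j) (below (xs ! j)))"
      using column[OF j, of "\<lambda>_. True"] by simp
    also have "\<dots> = Suc (card (below (xs ! j)))"
      by (rule card_insert_disjoint) (simp, simp add: below_def)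
    finally show ?thesis using inX[OF j] card_gt_0_iff[of "below (xs ! j)"]
      by (auto simp: tops_def Suc_le_eq)
  qed
  \<comment> \<open>The top also occurs in its own column. Having nothing above it, it has row sum
    \<open>1\<close> and enters neither count.\<close>
  have counts: "exclusive_count m j ?n = card (exclusive (xs ! j))"
    "shared_count m j ?n = card (shared (xs ! j))" if j: "j < ?n" "xs ! j \<in> tops" for j
  proof -
    have "{x \<in> X. (x, xs ! j) \<in> P \<and> Suc (card (above x)) = 2} = exclusive (xs ! j)"
      "{x \<in> X. (x, xs ! j) \<in> P \<and> 2 < Suc (card (above x))} = shared (xs ! j)"
      using above_top[OF j(2)] by (auto simp: exclusive_def shared_def below_def)
    then show "exclusive_count m j ?n = card (exclusive (xs ! j))"
      "shared_count m j ?n = card (shared (xs ! j))"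
      using column[OF j(1), of "\<lambda>k. k = 2"] column[OF j(1), of "\<lambda>k. 2 < k"] by simp_all
  qed
  have "top_count m (m 0) = (\<Sum>j<?n. of_bool (xs ! j \<in> tops))"
    unfolding top_count_def size using below by (intro sum.cong) simp_all
  also have "\<dots> = (\<Sum>y\<in>X. of_bool (y \<in> tops))"
    using sum_nth_eq_sum_set[OF xs(1), of "\<lambda>y. of_bool (y \<in> tops)"] by (simp only: xs(2))
  also have "\<dots> = card tops" using finite_X tops_subset by (simp add: Int_absorb1)
  finally show "top_count m (m 0) = card tops" .
  have "bad_top_before m (m 0) \<longleftrightarrow>
      (\<exists>j<?n. xs ! j \<in> tops \<and> card (exclusive (xs ! j)) \<le> card (shared (xs ! j)))"
    unfolding bad_top_before_def size using below counts by auto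
  also have "\<dots> \<longleftrightarrow> (\<exists>y\<in>tops. card (exclusive y) \<le> card (shared y))"
    using tops_subset xs(2) by (metis in_set_conv_nth subsetD)
  finally show "bad_top_before m (m 0) \<longleftrightarrow> (\<exists>y\<in>tops. card (exclusive y) \<le> card (shared y))" .
qed

end

lemma game_program_correct:
  assumes game: "poset_game X F P" and height: "poset_height P = 2"
    and tops: "\<forall>y\<in>X. \<not> minimal_element X P y \<longrightarrow> {y} \<in> F"
    and enc: "encodes inp X F P"
  shows "\<exists>t. computes game_program inp t (of_bool (two_level_poset.maker_criterion X P F)) \<and>
    t \<le> 600 * length inp ^ 3 + 600"
proof -
  interpret two_level_poset X P by (rule two_level_posetI[OF game height])
  obtain xs Ws where xs: "distinct xs" "set xs = X" and Ws: "distinct Ws" "set Ws = F"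
    and inp: "inp = encode_game xs Ws P"
    using enc by (auto simp: encodes_def)
  let ?n = "length xs"
  define m where "m i = (if i < length inp then inp ! i else 0)" for i
  define R :: "nat \<Rightarrow> nat" where "R = (\<lambda>_. 0)(0 := length inp)"
  have n: "card X = ?n" using xs distinct_card by blast
  have F: "card F = length Ws" using Ws distinct_card by blast
  note nth = encode_game_nth[where xs = xs and Ws = Ws and P = P, folded inp]
  have m0: "m 0 = ?n" using nth(1,4) by (auto simp: m_def)
  have entry: "m (1 + i * ?n + j) = of_bool ((xs ! i, xs ! j) \<in> P)" if "i < ?n" "j < ?n" for i j
  proof -
    have "Suc i * ?n \<le> ?n * ?n" using that(1) by (intro mult_le_mono1) simp
    then have "1 + i * ?n + j < length inp" using that(2) nth(4) by simp
    then show ?thesis using nth(2)[OF that] by (simp add: m_def)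
  qed
  have mF: "m (1 + ?n * ?n) = card F" using nth(3,4) F by (simp add: m_def)
  have "refl_on X P" using game by (auto simp: poset_game_def partial_order_on_def preorder_on_def)
  note counts = program_counts[OF this xs m0 entry]
  \<comment> \<open>This yields \<open>card tops \<le> card F\<close>, so the strict comparison made
    by the program is equivalent to \<open>card F \<noteq> card tops\<close>.\<close>
  have "(\<lambda>y. {y}) ` tops \<subseteq> F" using tops by (auto simp: minimal_iff tops_def)
  then have "card ((\<lambda>y. {y}) ` tops) \<le> card F" using Ws by (intro card_mono) auto
  then have "card tops \<le> card F" by (simp add: card_image)
  then have crit: "top_count m (m 0) < m (1 + m 0 * m 0) \<or> odd (m 0) \<or> bad_top_before m (m 0) \<longleftrightarrow>
      maker_criterion F"
    using counts mF n by (auto simp: maker_criterion_def m0)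
  have "X \<noteq> {}" using two_level_posetI(2)[OF game height] tops_subset by blast
  then have pos: "0 < m 0" using xs m0 by auto
  have "\<forall>r>0. R r = 0" by (simp add: R_def)
  then obtain t R' where run: "exec game_program (R, m) t (R', m)" "R' 0 = of_bool (maker_criterion F)"
    and t: "t \<le> 100 * m 0 ^ 3 + 200 * m 0 ^ 2 + 200 * m 0 + 100"
    using triple_game_program[of m, OF pos] unfolding triple_def crit by blast
  have "initial_state inp = (R, m)" by (simp add: initial_state_def R_def m_def[abs_def])
  then have "computes game_program inp t (of_bool (maker_criterion F))"
    unfolding computes_def using run by (intro exI[of _ "(R', m)"]) simp
  moreover have "t \<le> 600 * length inp ^ 3 + 600"
  proof -
    have N: "m 0 \<le> length inp" "1 \<le> length inp"
      using nth(4) le_square[of ?n] unfolding m0 by linarith+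
    have "m 0 ^ 3 \<le> length inp ^ 3" by (rule power_mono) (use N(1) in simp_all)
    moreover have "m 0 ^ 2 \<le> length inp ^ 2" by (rule power_mono) (use N(1) in simp_all)
    moreover have "length inp ^ 2 \<le> length inp ^ 3" by (rule power_increasing) (use N(2) in simp_all)
    moreover have "length inp \<le> length inp ^ 3" using power_increasing[of 1 3 "length inp"] N(2) by simp
    \<comment> \<open>Bounding every power by the cube gives the coefficient
      \<open>100 + 200 + 200\<close>, which is below \<open>600\<close>.\<close>
    ultimately show ?thesis using t N(1) by linarith
  qed
  ultimately show ?thesis by blast
qed

theorem theorem2:
  shows "\<exists>(prog :: com) (c :: nat) (k :: nat).
    \<forall>(X :: nat set) (F :: nat set set) (P :: nat rel) (inp :: nat list).
      poset_game X F P \<and> poset_height P = 2 \<and> (\<forall>W\<in>F. card W = 1) \<and>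
      (\<forall>y\<in>X. \<not> minimal_element X P y \<longrightarrow> {y} \<in> F) \<and> encodes inp X F P \<longrightarrow>
      (\<exists>t out. computes prog inp t out \<and> t \<le> c * length inp ^ k + c \<and>
         (\<forall>q. out = player_code q \<longleftrightarrow> has_winning_strategy Maker X F P q) \<and>
         out \<in> range player_code)"
proof (rule exI[of _ game_program], rule exI[of _ 600], rule exI[of _ 3], intro allI impI, elim conjE)
  fix X F P and inp :: "nat list"
  assume game: "poset_game X F P" and height: "poset_height P = 2"
    and singletons: "\<forall>W\<in>F. card W = 1"
    and tops: "\<forall>y\<in>X. \<not> minimal_element X P y \<longrightarrow> {y} \<in> F"
    and enc: "encodes inp X F P"
  interpret two_level_poset X P by (rule two_level_posetI[OF game height])
  have "F \<subseteq> Pow X" using game by (simp add: poset_game_def)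
  moreover have "{y} \<in> F" if "y \<in> tops" for y
    using that tops tops_subset by (auto simp: minimal_iff)
  ultimately have wins: "has_winning_strategy Maker X F P Maker \<longleftrightarrow> maker_criterion F"
      "has_winning_strategy Maker X F P Breaker \<longleftrightarrow> \<not> maker_criterion F"
    using winning_strategy_iff_criterion[OF two_level_posetI(2)[OF game height]] singletons by blast+
  let ?out = "of_bool (maker_criterion F) :: nat"
  obtain t where t: "computes game_program inp t ?out" "t \<le> 600 * length inp ^ 3 + 600"
    using game_program_correct[OF game height tops enc] by blast
  have "?out = player_code q \<longleftrightarrow> has_winning_strategy Maker X F P q" for q
    using wins by (cases q) simp_all
  moreover have "?out = player_code (if maker_criterion F then Maker else Breaker)" by simp
  then have "?out \<in> range player_code" by (metis rangeI)
  ultimately show "\<exists>t out. computes game_program inp t out \<and> t \<le> 600 * length inp ^ 3 + 600 \<and>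
      (\<forall>q. out = player_code q \<longleftrightarrow> has_winning_strategy Maker X F P q) \<and> out \<in> range player_code"
    using t by blast
qed

end
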